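(* Let $\mathtt{P}=(\mathtt{P_{yes}},\mathtt{P_{no}})$ be a promise problem over a unary alphabet $\{a\}$. If $\mathtt{P}$ is solved by a probabilistic finite automaton with error bound $\epsilon<\frac12$, then $\mathtt{P}$ is also solvable by a deterministic finite automaton (i.e. a DFA accepting every string of $\mathtt{P_{yes}}$ and rejecting every string of $\mathtt{P_{no}}$).
   Context: A promise problem over $\Sigma$ is a pair of disjoint languages $\mathtt{P_{yes}},\mathtt{P_{no}}\subseteq\Sigma^*$. A probabilistic finite automaton (PFA) is $(Q,\Sigma,\{A_\sigma\}_{\sigma\in\Sigma},v_0,Q_a)$ with finite state set $Q$, column-stochastic matrices $A_\sigma$ ($A_\sigma(j,i)$ is the probability of moving from state $i$ to state $j$ on $\sigma$), stochastic initial vector $v_0$, and accepting set $Q_a$; on input $w=w_1\cdots w_\ell$ the final vector is $v_\ell=A_{w_\ell}\cdots A_{w_1}v_0$ and the acceptance probability is $\sum_{q_j\in Q_a}v_\ell(j)$. A PFA solves $\mathtt{P}$ with error bound $\epsilon<\frac12$ if every yes-instance is accepted with probability at least $1-\epsilon$ and every no-instance is rejected with probability at least $1-\epsilon$. *)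

theory Defs
  imports Complex_Main "Jordan_Normal_Form.Matrix"
begin

type_synonym 'a promise_problem = "'a list set \<times> 'a list set"

definition promise_problem :: "'a set \<Rightarrow> 'a promise_problem \<Rightarrow> bool" where
  "promise_problem \<Sigma> P \<longleftrightarrow>
     fst P \<subseteq> lists \<Sigma> \<and> snd P \<subseteq> lists \<Sigma> \<and> fst P \<inter> snd P = {}"

definition stochastic_vec :: "nat \<Rightarrow> real vec \<Rightarrow> bool" where
  "stochastic_vec n v \<longleftrightarrow>
     v \<in> carrier_vec n \<and> (\<forall>i<n. 0 \<le> v $ i) \<and> (\<Sum>i<n. v $ i) = 1"

definition column_stochastic :: "nat \<Rightarrow> real mat \<Rightarrow> bool" where
  "column_stochastic n A \<longleftrightarrow> A \<in> carrier_mat n n \<and> (\<forall>i<n. stochastic_vec n (col A i))"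

text \<open>The states of a PFA are numbered from 0, so that the state set is \<open>{..<n}\<close> with
  \<open>n\<close> the field \<open>pfa_dim\<close>; a transition matrix has the probability of moving from
  state \<open>i\<close> to state \<open>j\<close> in row \<open>j\<close> and column \<open>i\<close>.\<close>

record 'a pfa =
  pfa_dim :: nat
  pfa_alphabet :: "'a set"
  pfa_mat :: "'a \<Rightarrow> real mat"
  pfa_init :: "real vec"
  pfa_accepting :: "nat set"

definition is_pfa :: "'a pfa \<Rightarrow> bool" where
  "is_pfa M \<longleftrightarrow>
     finite (pfa_alphabet M) \<and>
     (\<forall>\<sigma>\<in>pfa_alphabet M. column_stochastic (pfa_dim M) (pfa_mat M \<sigma>)) \<and>
     stochastic_vec (pfa_dim M) (pfa_init M) \<and>
     pfa_accepting M \<subseteq> {..<pfa_dim M}"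

definition pfa_final_vec :: "'a pfa \<Rightarrow> 'a list \<Rightarrow> real vec" where
  "pfa_final_vec M w = fold (\<lambda>\<sigma> v. pfa_mat M \<sigma> *\<^sub>v v) w (pfa_init M)"

definition pfa_acc_prob :: "'a pfa \<Rightarrow> 'a list \<Rightarrow> real" where
  "pfa_acc_prob M w = (\<Sum>j\<in>pfa_accepting M. pfa_final_vec M w $ j)"

definition pfa_rej_prob :: "'a pfa \<Rightarrow> 'a list \<Rightarrow> real" where
  "pfa_rej_prob M w = 1 - pfa_acc_prob M w"

definition pfa_solves :: "'a pfa \<Rightarrow> 'a promise_problem \<Rightarrow> real \<Rightarrow> bool" where
  "pfa_solves M P \<epsilon> \<longleftrightarrow>
     (\<forall>w\<in>fst P. pfa_acc_prob M w \<ge> 1 - \<epsilon>) \<and>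
     (\<forall>w\<in>snd P. pfa_rej_prob M w \<ge> 1 - \<epsilon>)"

record ('q, 'a) dfa =
  dfa_states :: "'q set"
  dfa_alphabet :: "'a set"
  dfa_trans :: "'q \<Rightarrow> 'a \<Rightarrow> 'q"
  dfa_init :: 'q
  dfa_accepting :: "'q set"

definition is_dfa :: "('q, 'a) dfa \<Rightarrow> bool" where
  "is_dfa D \<longleftrightarrow>
     finite (dfa_states D) \<and> finite (dfa_alphabet D) \<and>
     (\<forall>q\<in>dfa_states D. \<forall>\<sigma>\<in>dfa_alphabet D. dfa_trans D q \<sigma> \<in> dfa_states D) \<and>
     dfa_init D \<in> dfa_states D \<and>
     dfa_accepting D \<subseteq> dfa_states D"

definition dfa_accepts :: "('q, 'a) dfa \<Rightarrow> 'a list \<Rightarrow> bool" where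
  "dfa_accepts D w \<longleftrightarrow> fold (\<lambda>\<sigma> q. dfa_trans D q \<sigma>) w (dfa_init D) \<in> dfa_accepting D"

definition dfa_solves :: "('q, 'a) dfa \<Rightarrow> 'a promise_problem \<Rightarrow> bool" where
  "dfa_solves D P \<longleftrightarrow> (\<forall>w\<in>fst P. dfa_accepts D w) \<and> (\<forall>w\<in>snd P. \<not> dfa_accepts D w)"

end

theory Submission
  imports Defs
begin

text \<open>Dually to the action of the chain on distributions, let the transition matrix act on functions
  by averaging. The support relations of the powers of the matrix form a finite
  semigroup, so some power \<open>d\<close> has an idempotent support: it is transitive, hence every class of
  recurrent states is aperiodic. For such a kernel the iterated averages converge: inside a class
  whose rows are all positive, oscillation shrinks geometrically; outside of these, each state
  leaks a fixed share of its weight into states where convergence is already known. So the acceptance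
  probability of \<open>a\<^sup>m\<close> converges along every residue class modulo \<open>d\<close>, and since yes- and no-instances
  are separated by the gap \<open>1 - 2\<epsilon>\<close>, from some point on a class contains only one
  kind of them.\<close>

subsection \<open>Averaging operators\<close>

definition stochastic_kernel :: "'s set \<Rightarrow> ('s \<Rightarrow> 's \<Rightarrow> real) \<Rightarrow> bool" where
  "stochastic_kernel S p \<longleftrightarrow> (\<forall>i\<in>S. (\<forall>j\<in>S. 0 \<le> p i j) \<and> (\<Sum>j\<in>S. p i j) = 1)"

definition kernel_op :: "'s set \<Rightarrow> ('s \<Rightarrow> 's \<Rightarrow> real) \<Rightarrow> ('s \<Rightarrow> real) \<Rightarrow> 's \<Rightarrow> real" where
  "kernel_op S p g i = (\<Sum>j\<in>S. p i j * g j)"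

primrec kernel_pow :: "'s set \<Rightarrow> ('s \<Rightarrow> 's \<Rightarrow> real) \<Rightarrow> nat \<Rightarrow> 's \<Rightarrow> 's \<Rightarrow> real" where
  "kernel_pow S p 0 i j = (if i = j then 1 else 0)"
| "kernel_pow S p (Suc m) i j = (\<Sum>l\<in>S. p i l * kernel_pow S p m l j)"

text \<open>A relation on states, so that \<open>O\<close> and \<open>^^\<close> on relations
  compute the supports of products and powers.\<close>

definition kernel_supp :: "'s set \<Rightarrow> ('s \<Rightarrow> 's \<Rightarrow> real) \<Rightarrow> ('s \<times> 's) set" where
  "kernel_supp S p = {(i, j). i \<in> S \<and> j \<in> S \<and> 0 < p i j}"

lemma stochastic_kernel_nonneg:
  assumes "stochastic_kernel S p" and "i \<in> S" and "j \<in> S"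
  shows "0 \<le> p i j"
  using assms unfolding stochastic_kernel_def by blast

lemma stochastic_kernel_sum:
  assumes "stochastic_kernel S p" and "i \<in> S"
  shows "(\<Sum>j\<in>S. p i j) = 1"
  using assms unfolding stochastic_kernel_def by blast

lemma kernel_op_cong:
  assumes "\<And>j. j \<in> S \<Longrightarrow> g j = h j"
  shows "kernel_op S p g i = kernel_op S p h i"
  unfolding kernel_op_def by (intro sum.cong) (auto simp: assms)

lemma kernel_op_pow:
  assumes "finite S" and "i \<in> S"
  shows "kernel_op S (kernel_pow S p m) g i = (kernel_op S p ^^ m) g i"
  using assms(2)
proof (induction m arbitrary: i)
  case 0
  then show ?case using assms(1) by (simp add: kernel_op_def if_distrib[of "\<lambda>x. x * _"] cong: if_cong)
next
  case (Suc m)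
  have "kernel_op S (kernel_pow S p (Suc m)) g i
      = (\<Sum>j\<in>S. \<Sum>l\<in>S. p i l * (kernel_pow S p m l j * g j))"
    by (simp add: kernel_op_def sum_distrib_right mult.assoc)
  also have "\<dots> = (\<Sum>l\<in>S. \<Sum>j\<in>S. p i l * (kernel_pow S p m l j * g j))"
    by (rule sum.swap)
  also have "\<dots> = (\<Sum>l\<in>S. p i l * kernel_op S (kernel_pow S p m) g l)"
    by (simp add: kernel_op_def sum_distrib_left)
  also have "\<dots> = kernel_op S p ((kernel_op S p ^^ m) g) i"
    using Suc.IH by (simp add: kernel_op_def[of S p "(kernel_op S p ^^ m) g"])
  finally show ?case by (simp del: kernel_pow.simps)
qed

text \<open>Iterating the \<open>d\<close>-step kernel samples the original iteration at multiples
  of \<open>d\<close>; convergence for a well-chosen power is carried back to \<open>p\<close> this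
  way.\<close>

lemma kernel_op_pow_funpow:
  assumes "finite S" and "i \<in> S"
  shows "(kernel_op S (kernel_pow S p d) ^^ k) g i = (kernel_op S p ^^ (d * k)) g i"
  using assms(2)
proof (induction k arbitrary: i)
  case 0
  then show ?case by simp
next
  case (Suc k)
  have "(kernel_op S (kernel_pow S p d) ^^ Suc k) g i
      = kernel_op S (kernel_pow S p d) ((kernel_op S p ^^ (d * k)) g) i"
    using Suc.IH by (auto intro: kernel_op_cong)
  also have "\<dots> = (kernel_op S p ^^ d) ((kernel_op S p ^^ (d * k)) g) i"
    by (rule kernel_op_pow[OF assms(1) Suc.prems])
  finally show ?case by (simp add: funpow_add)
qed

lemma stochastic_kernel_pow:
  assumes "finite S" and p: "stochastic_kernel S p"
  shows "stochastic_kernel S (kernel_pow S p m)"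
proof (induction m)
  case 0
  then show ?case using assms(1) by (simp add: stochastic_kernel_def)
next
  case (Suc m)
  have "(\<Sum>j\<in>S. kernel_pow S p (Suc m) i j) = 1" if "i \<in> S" for i
  proof -
    have "(\<Sum>j\<in>S. kernel_pow S p (Suc m) i j) = (\<Sum>l\<in>S. \<Sum>j\<in>S. p i l * kernel_pow S p m l j)"
      unfolding kernel_pow.simps by (rule sum.swap)
    also have "\<dots> = (\<Sum>l\<in>S. p i l * (\<Sum>j\<in>S. kernel_pow S p m l j))"
      by (simp add: sum_distrib_left)
    also have "\<dots> = (\<Sum>l\<in>S. p i l)"
      by (intro sum.cong refl) (simp add: stochastic_kernel_sum[OF Suc.IH])
    finally show ?thesis using stochastic_kernel_sum[OF p that] by simp
  qed
  moreover have "0 \<le> kernel_pow S p (Suc m) i j" if "i \<in> S" "j \<in> S" for i j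
    unfolding kernel_pow.simps using that
    by (intro sum_nonneg mult_nonneg_nonneg stochastic_kernel_nonneg[OF p] stochastic_kernel_nonneg[OF Suc.IH])
  ultimately show ?case unfolding stochastic_kernel_def by blast
qed

section \<open>Supports of powers\<close>

text \<open>A sum of nonnegative terms is positive exactly when some term is, so nothing cancels and
  a positive entry of a power is a path in the support. At exponent 0 the right side would be the
  identity on the whole type, not only on \<open>S\<close>.\<close>

lemma kernel_supp_pow:
  assumes S: "finite S" and p: "stochastic_kernel S p" and "0 < m"
  shows "kernel_supp S (kernel_pow S p m) = kernel_supp S p ^^ m"
proof -
  note nn = stochastic_kernel_nonneg[OF stochastic_kernel_pow[OF S p]]
  note pn = stochastic_kernel_nonneg[OF p]
  have "0 < kernel_pow S p m i j \<longleftrightarrow> (i, j) \<in> kernel_supp S p ^^ m" if "i \<in> S" "j \<in> S" for i j m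
    using that
  proof (induction m arbitrary: i)
    case 0
    then show ?case by simp
  next
    case (Suc m)
    have "0 < kernel_pow S p (Suc m) i j \<longleftrightarrow> kernel_pow S p (Suc m) i j \<noteq> 0"
      using nn[OF Suc.prems, of "Suc m"] by linarith
    also have "\<dots> \<longleftrightarrow> (\<exists>l\<in>S. p i l * kernel_pow S p m l j \<noteq> 0)"
      unfolding kernel_pow.simps using Suc.prems
      by (subst sum_nonneg_eq_0_iff[OF S mult_nonneg_nonneg[OF pn nn]]) blast+
    also have "\<dots> \<longleftrightarrow> (\<exists>l\<in>S. 0 < p i l \<and> 0 < kernel_pow S p m l j)"
      using Suc.prems nn pn by (simp add: less_le)
    also have "\<dots> \<longleftrightarrow> (\<exists>l. (i, l) \<in> kernel_supp S p \<and> (l, j) \<in> kernel_supp S p ^^ m)"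
      using Suc by (auto simp: kernel_supp_def)
    also have "\<dots> \<longleftrightarrow> (i, j) \<in> kernel_supp S p ^^ Suc m"
      by (metis relpow_Suc_D2 relpow_Suc_I2)
    finally show ?case .
  qed
  moreover have "kernel_supp S p ^^ m \<subseteq> S \<times> S"
  proof -
    obtain m' where "m = Suc m'" using \<open>0 < m\<close> gr0_implies_Suc by blast
    moreover have "(i, j) \<in> S \<times> S" if "(i, j) \<in> kernel_supp S p ^^ Suc m'" for i j
      using relpow_Suc_D2[OF that] that by (auto simp: kernel_supp_def)
    ultimately show ?thesis by auto
  qed
  ultimately show ?thesis by (auto simp: kernel_supp_def)
qed

text \<open>The powers lie in a finite set, so they become periodic with some period
  \<open>q\<close>; an exponent that is a multiple of \<open>q\<close> and past the preperiod is
  idempotent.\<close>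

lemma relpow_idempotent_exists:
  fixes R :: "('s \<times> 's) set"
  assumes "finite S" and "R \<subseteq> S \<times> S"
  obtains d where "0 < d" and "R ^^ d O R ^^ d = R ^^ d"
proof -
  \<comment> \<open>Positive exponents only: \<open>R ^^ 0\<close> is the identity on the whole type
    and may leave \<open>S \<times> S\<close>.\<close>
  have sub: "R ^^ Suc m \<subseteq> S \<times> S" for m
    using assms(2) by (induction m) auto
  have "\<not> inj (\<lambda>m. R ^^ Suc m)"
  proof
    assume "inj (\<lambda>m. R ^^ Suc m)"
    moreover have "range (\<lambda>m. R ^^ Suc m) \<subseteq> Pow (S \<times> S)" using sub by blast
    ultimately show False
      using assms(1) finite_subset[of _ "Pow (S \<times> S)"] finite_imageD[of _ "UNIV :: nat set"] by auto
  qed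
  then obtain a b where ab: "a < b" "R ^^ a = R ^^ b"
    by (metis (mono_tags, lifting) Suc_less_eq injI linorder_neqE_nat)
  define q where "q = b - a"
  have per: "R ^^ (m + q) = R ^^ m" if "a \<le> m" for m
  proof -
    have "R ^^ (m + q) = R ^^ (b + (m - a))" using that ab(1) by (simp add: q_def add.commute)
    also have "\<dots> = R ^^ (a + (m - a))" by (simp only: relpow_add ab(2))
    finally show ?thesis using that by simp
  qed
  have per': "R ^^ (m + t * q) = R ^^ m" if "a \<le> m" for m t
  proof (induction t)
    case (Suc t)
    then show ?case using per[of "m + t * q"] that by (simp add: ac_simps)
  qed simp
  \<comment> \<open>A positive multiple of \<open>q\<close> that is at least \<open>a\<close>; hence
    \<open>R ^^ (d + d) = R ^^ d\<close> is an instance of \<open>per'\<close>.\<close>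
  define d where "d = Suc a * q"
  have "0 < q" using ab(1) by (simp add: q_def)
  then have "a \<le> d" "0 < d" unfolding d_def by (cases q; simp)+
  then have "R ^^ d O R ^^ d = R ^^ d"
    using per'[of d "Suc a"] by (simp add: d_def flip: relpow_add)
  with \<open>0 < d\<close> show thesis by (rule that)
qed

subsection \<open>Convergence of iterated averages\<close>

lemma convergent_if_eventually_close:
  fixes x :: "nat \<Rightarrow> real"
  assumes "\<And>e. 0 < e \<Longrightarrow> \<exists>N. \<forall>k\<ge>N. \<forall>l\<ge>N. \<bar>x k - x l\<bar> \<le> e"
  shows "convergent x"
proof -
  have "Cauchy x"
  proof (rule metric_CauchyI)
    fix e :: real assume "0 < e"
    then obtain N where N: "\<forall>k\<ge>N. \<forall>l\<ge>N. \<bar>x k - x l\<bar> \<le> e / 2" using assms[of "e / 2"] by auto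
    have "dist (x k) (x l) < e" if "N \<le> k" "N \<le> l" for k l
    proof -
      have "\<bar>x k - x l\<bar> \<le> e / 2" using N that by blast
      then show ?thesis unfolding dist_real_def using \<open>0 < e\<close> by linarith
    qed
    then show "\<exists>N. \<forall>k\<ge>N. \<forall>l\<ge>N. dist (x k) (x l) < e" by blast
  qed
  then show ?thesis by (simp add: Cauchy_convergent_iff)
qed

section \<open>Contraction estimates for averages\<close>

text \<open>Weight \<open>\<delta>\<close> is set aside at the single state \<open>i\<close> and
  everything else is bounded by \<open>b\<close>. Together with the mirror image for lower bounds,
  both ends of a range are pulled towards the same value \<open>y i\<close>.\<close>

lemma convex_sum_le:
  fixes p y :: "'s \<Rightarrow> real"
  assumes U: "finite U" and p: "\<And>j. j \<in> U \<Longrightarrow> 0 \<le> p j" "sum p U = 1"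
    and i: "i \<in> U" "\<delta> \<le> p i" and y: "\<And>j. j \<in> U \<Longrightarrow> y j \<le> b"
  shows "(\<Sum>j\<in>U. p j * y j) \<le> (1 - \<delta>) * b + \<delta> * y i"
proof -
  have "(\<Sum>j\<in>U. p j * y j) = p i * y i + (\<Sum>j\<in>U - {i}. p j * y j)"
    using U i by (simp add: sum.remove)
  also have "\<dots> \<le> p i * y i + (\<Sum>j\<in>U - {i}. p j * b)"
    using p y by (intro add_left_mono sum_mono mult_left_mono) auto
  also have "\<dots> = p i * y i + (1 - p i) * b"
    using p(2) U i by (simp add: sum.remove[of U i] flip: sum_distrib_right)
  \<comment> \<open>The two sides differ by \<open>(p i - \<delta>) * (b - y i)\<close>.\<close>
  also have "\<dots> \<le> (1 - \<delta>) * b + \<delta> * y i"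
    using mult_nonneg_nonneg[of "p i - \<delta>" "b - y i"] i y[OF i(1)] by (simp add: algebra_simps)
  finally show ?thesis .
qed

lemma convex_sum_ge:
  fixes p y :: "'s \<Rightarrow> real"
  assumes "finite U" and "\<And>j. j \<in> U \<Longrightarrow> 0 \<le> p j" "sum p U = 1"
    and "i \<in> U" "\<delta> \<le> p i" and "\<And>j. j \<in> U \<Longrightarrow> a \<le> y j"
  shows "(1 - \<delta>) * a + \<delta> * y i \<le> (\<Sum>j\<in>U. p j * y j)"
  using convex_sum_le[OF assms(1-5), of "\<lambda>j. - y j" "- a"] assms(6) by (simp add: sum_negf)

lemma power_mult_le_exists:
  fixes r K e :: real
  assumes "0 \<le> r" "r < 1" "0 < e"
  obtains t where "r ^ t * K \<le> e"
proof -
  have "(\<lambda>t. r ^ t * K) \<longlonglongrightarrow> 0 * K"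
    using assms by (intro tendsto_intros LIMSEQ_power_zero) auto
  then have "\<forall>\<^sub>F t in sequentially. r ^ t * K < e"
    using assms(3) by (simp add: order_tendstoD(2))
  then obtain t where "r ^ t * K < e" by (auto simp: eventually_sequentially)
  then show thesis using that[of t] by simp
qed

text \<open>Every row gives at least \<open>\<delta>\<close> to the same state \<open>i\<close>, so
  one step shrinks an interval containing all values by the factor \<open>1 - \<delta>\<close>, and
  later values never leave it. Hence the sequence is Cauchy.\<close>

lemma convergent_positive_averages:
  fixes x :: "nat \<Rightarrow> 's \<Rightarrow> real"
  assumes U: "finite U" and p: "\<And>i. i \<in> U \<Longrightarrow> (\<Sum>j\<in>U. p i j) = 1"
    and \<delta>: "0 < \<delta>" "\<And>i j. i \<in> U \<Longrightarrow> j \<in> U \<Longrightarrow> \<delta> \<le> p i j"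
    and x: "\<And>k i. i \<in> U \<Longrightarrow> x (Suc k) i = (\<Sum>j\<in>U. p i j * x k j)"
    and i: "i \<in> U"
  shows "convergent (\<lambda>k. x k i)"
proof -
  have nn: "0 \<le> p i j" if "i \<in> U" "j \<in> U" for i j using \<delta>(1) \<delta>(2)[OF that] by linarith
  have "p i i \<le> (\<Sum>j\<in>U. p i j)" using i U nn by (intro member_le_sum) auto
  then have \<delta>1: "\<delta> \<le> 1" using \<delta>(2)[OF i i] p[OF i] by simp
  \<comment> \<open>Width of the initial interval, which reaches from minus to plus the sum of
    absolute values.\<close>
  define K where "K = 2 * (\<Sum>j\<in>U. \<bar>x 0 j\<bar>)"
  have stay: "\<forall>k\<ge>N. \<forall>j\<in>U. a \<le> x k j \<and> x k j \<le> b" if *: "\<forall>j\<in>U. a \<le> x N j \<and> x N j \<le> b" for a b N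
  proof (intro allI impI)
    fix k assume "N \<le> k"
    then show "\<forall>j\<in>U. a \<le> x k j \<and> x k j \<le> b"
    proof (induction k rule: dec_induct)
      case base
      then show ?case by (rule *)
    next
      case (step k)
      have "a \<le> x (Suc k) j \<and> x (Suc k) j \<le> b" if j: "j \<in> U" for j
      proof
        have bd: "a \<le> x k m" "x k m \<le> b" if "m \<in> U" for m using step.IH that by auto
        \<comment> \<open>The convexity bounds are used with weight 0, read off
          \<open>0 \<le> p j j\<close>.\<close>
        show "a \<le> x (Suc k) j"
          using convex_sum_ge[OF U nn[OF j] p[OF j] j nn[OF j j] bd(1)] by (simp add: x[OF j])
        show "x (Suc k) j \<le> b"
          using convex_sum_le[OF U nn[OF j] p[OF j] j nn[OF j j] bd(2)] by (simp add: x[OF j])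
      qed
      then show ?case by blast
    qed
  qed
  have shrink: "\<exists>a b. b - a \<le> (1 - \<delta>) ^ t * K \<and> (\<forall>j\<in>U. a \<le> x t j \<and> x t j \<le> b)" for t
  proof (induction t)
    case 0
    let ?B = "\<Sum>j\<in>U. \<bar>x 0 j\<bar>"
    have "- ?B \<le> x 0 j \<and> x 0 j \<le> ?B" if "j \<in> U" for j
      using member_le_sum[OF that abs_ge_zero U, of "x 0"] by linarith
    moreover have "?B - - ?B \<le> (1 - \<delta>) ^ 0 * K" by (simp add: K_def)
    ultimately show ?case by blast
  next
    case (Suc t)
    then obtain a b where ab: "b - a \<le> (1 - \<delta>) ^ t * K" "\<forall>j\<in>U. a \<le> x t j \<and> x t j \<le> b" by blast
    \<comment> \<open>The shift \<open>\<delta> * x t i\<close> is common to both ends and cancels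
      in the width.\<close>
    have "((1 - \<delta>) * b + \<delta> * x t i) - ((1 - \<delta>) * a + \<delta> * x t i) \<le> (1 - \<delta>) ^ Suc t * K"
      using mult_left_mono[OF ab(1), of "1 - \<delta>"] \<delta>1 by (simp add: algebra_simps)
    moreover have "(1 - \<delta>) * a + \<delta> * x t i \<le> x (Suc t) j \<and> x (Suc t) j \<le> (1 - \<delta>) * b + \<delta> * x t i"
      if "j \<in> U" for j
    proof
      have bd: "a \<le> x t m" "x t m \<le> b" if "m \<in> U" for m using ab(2) that by auto
      show "(1 - \<delta>) * a + \<delta> * x t i \<le> x (Suc t) j"
        unfolding x[OF that] by (rule convex_sum_ge[OF U nn[OF that] p[OF that] i \<delta>(2)[OF that i] bd(1)])
      show "x (Suc t) j \<le> (1 - \<delta>) * b + \<delta> * x t i"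
        unfolding x[OF that] by (rule convex_sum_le[OF U nn[OF that] p[OF that] i \<delta>(2)[OF that i] bd(2)])
    qed
    ultimately show ?case by blast
  qed
  show ?thesis
  proof (rule convergent_if_eventually_close)
    fix e :: real assume "0 < e"
    then obtain t where t: "(1 - \<delta>) ^ t * K \<le> e"
      using power_mult_le_exists[of "1 - \<delta>" e K] \<delta>(1) \<delta>1 by auto
    obtain a b where ab: "b - a \<le> (1 - \<delta>) ^ t * K" "\<forall>j\<in>U. a \<le> x t j \<and> x t j \<le> b"
      using shrink by blast
    have "\<bar>x k i - x l i\<bar> \<le> e" if "t \<le> k" "t \<le> l" for k l
    proof -
      have "a \<le> x k i \<and> x k i \<le> b" "a \<le> x l i \<and> x l i \<le> b"
        using stay[OF ab(2)] that i by blast+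
      then show ?thesis using ab(1) t by linarith
    qed
    then show "\<exists>N. \<forall>k\<ge>N. \<forall>l\<ge>N. \<bar>x k i - x l i\<bar> \<le> e" by blast
  qed
qed

text \<open>The difference of the values at two times obeys the same recurrence. Differences on
  \<open>W\<close> become small, and a bound on \<open>V\<close> enters the next step with weight at
  most \<open>1 - \<delta>\<close>, so it decays geometrically up to a small error.\<close>

lemma convergent_leaking_averages:
  fixes x :: "nat \<Rightarrow> 's \<Rightarrow> real"
  assumes fin: "finite V" "finite W" and disj: "V \<inter> W = {}"
    and p: "\<And>i j. i \<in> V \<Longrightarrow> j \<in> V \<union> W \<Longrightarrow> 0 \<le> p i j" "\<And>i. i \<in> V \<Longrightarrow> (\<Sum>j\<in>V \<union> W. p i j) \<le> 1"
    and \<delta>: "0 < \<delta>" "\<delta> \<le> 1" "\<And>i. i \<in> V \<Longrightarrow> (\<Sum>j\<in>V. p i j) \<le> 1 - \<delta>"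
    and bd: "\<And>k i. i \<in> V \<Longrightarrow> \<bar>x k i\<bar> \<le> B"
    and x: "\<And>k i. i \<in> V \<Longrightarrow> x (Suc k) i = (\<Sum>j\<in>V \<union> W. p i j * x k j)"
    and W: "\<And>j. j \<in> W \<Longrightarrow> convergent (\<lambda>k. x k j)"
    and i: "i \<in> V"
  shows "convergent (\<lambda>k. x k i)"
proof (rule convergent_if_eventually_close)
  fix e :: real assume "0 < e"
  define \<epsilon> where "\<epsilon> = e / 2"
  have \<epsilon>: "0 < \<epsilon>" using \<open>0 < e\<close> by (simp add: \<epsilon>_def)
  \<comment> \<open>The tolerance makes \<open>\<epsilon>\<close> the fixed point of the update of
    \<open>C\<close> to \<open>(1 - \<delta>) * C + \<delta> * \<epsilon>\<close>, so errors coming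
    from \<open>W\<close> do not accumulate.\<close>
  have "\<exists>N. \<forall>k\<ge>N. \<forall>l\<ge>N. \<bar>x k j - x l j\<bar> < \<delta> * \<epsilon>" if "j \<in> W" for j
    using W[OF that] \<epsilon> \<delta>(1)
    by (auto simp: Cauchy_def dist_real_def simp flip: Cauchy_convergent_iff)
  then obtain n where n: "\<And>j k l. j \<in> W \<Longrightarrow> n j \<le> k \<Longrightarrow> n j \<le> l \<Longrightarrow> \<bar>x k j - x l j\<bar> < \<delta> * \<epsilon>"
    by metis
  define N0 where "N0 = (\<Sum>j\<in>W. n j)"
  have N0: "\<bar>x k j - x l j\<bar> \<le> \<delta> * \<epsilon>" if "j \<in> W" "N0 \<le> k" "N0 \<le> l" for j k l
  proof -
    have "n j \<le> N0" unfolding N0_def using that(1) fin(2) by (intro member_le_sum) auto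
    then show ?thesis using n[OF that(1), of k l] that by simp
  qed
  have shrink: "\<forall>k\<ge>N0 + t. \<forall>l\<ge>N0 + t. \<forall>j\<in>V. \<bar>x k j - x l j\<bar> \<le> (1 - \<delta>) ^ t * (2 * B) + \<epsilon>" for t
  proof (induction t)
    case 0
    have "\<bar>x k j - x l j\<bar> \<le> (1 - \<delta>) ^ 0 * (2 * B) + \<epsilon>" if "j \<in> V" for k l j
      unfolding power_0 using bd[OF that, of k] bd[OF that, of l] \<epsilon> by linarith
    then show ?case by blast
  next
    case (Suc t)
    define C where "C = (1 - \<delta>) ^ t * (2 * B) + \<epsilon>"
    have "0 \<le> B" using bd[OF i, of 0] by linarith
    then have C: "0 \<le> C" using \<delta> \<epsilon> by (simp add: C_def)
    have "\<bar>x k j - x l j\<bar> \<le> (1 - \<delta>) ^ Suc t * (2 * B) + \<epsilon>"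
      if k: "N0 + Suc t \<le> k" and l: "N0 + Suc t \<le> l" and j: "j \<in> V" for k l j
    proof -
      obtain k' l' where kl: "k = Suc k'" "l = Suc l'" "N0 + t \<le> k'" "N0 + t \<le> l'"
        using k l by (cases k; cases l) auto
      have "\<bar>x k j - x l j\<bar> = \<bar>\<Sum>m\<in>V \<union> W. p j m * (x k' m - x l' m)\<bar>"
        using x[OF j] kl by (simp add: sum_subtractf right_diff_distrib)
      also have "\<dots> \<le> (\<Sum>m\<in>V \<union> W. \<bar>p j m * (x k' m - x l' m)\<bar>)" by (rule sum_abs)
      also have "\<dots> = (\<Sum>m\<in>V \<union> W. p j m * \<bar>x k' m - x l' m\<bar>)"
        using p(1)[OF j] by (intro sum.cong) (auto simp: abs_mult)
      also have "\<dots> = (\<Sum>m\<in>V. p j m * \<bar>x k' m - x l' m\<bar>) + (\<Sum>m\<in>W. p j m * \<bar>x k' m - x l' m\<bar>)"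
        using fin disj by (rule sum.union_disjoint)
      also have "\<dots> \<le> (\<Sum>m\<in>V. p j m * C) + (\<Sum>m\<in>W. p j m * (\<delta> * \<epsilon>))"
      proof (intro add_mono sum_mono mult_left_mono)
        show "\<bar>x k' m - x l' m\<bar> \<le> C" if "m \<in> V" for m using Suc.IH kl that unfolding C_def by blast
        show "\<bar>x k' m - x l' m\<bar> \<le> \<delta> * \<epsilon>" if "m \<in> W" for m
          using kl by (intro N0[OF that]) linarith+
      qed (use p(1)[OF j] in blast)+
      also have "\<dots> = (\<Sum>m\<in>V. p j m) * C + (\<Sum>m\<in>W. p j m) * (\<delta> * \<epsilon>)"
        by (simp add: sum_distrib_right)
      also have "\<dots> \<le> (1 - \<delta>) * C + 1 * (\<delta> * \<epsilon>)"
      proof (intro add_mono mult_right_mono)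
        have "(\<Sum>m\<in>V \<union> W. p j m) = (\<Sum>m\<in>V. p j m) + (\<Sum>m\<in>W. p j m)"
          using fin disj by (rule sum.union_disjoint)
        moreover have "0 \<le> (\<Sum>m\<in>V. p j m)" using p(1)[OF j] by (auto intro: sum_nonneg)
        ultimately show "(\<Sum>m\<in>W. p j m) \<le> 1" using p(2)[OF j] by linarith
      qed (use C \<delta> \<epsilon> j in auto)
      finally show ?thesis by (simp add: C_def algebra_simps)
    qed
    then show ?case by blast
  qed
  obtain t where t: "(1 - \<delta>) ^ t * (2 * B) \<le> \<epsilon>"
    using power_mult_le_exists[of "1 - \<delta>" \<epsilon> "2 * B"] \<delta> \<epsilon> by auto
  have "\<bar>x k i - x l i\<bar> \<le> e" if "N0 + t \<le> k" "N0 + t \<le> l" for k l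
  proof -
    have "\<bar>x k i - x l i\<bar> \<le> (1 - \<delta>) ^ t * (2 * B) + \<epsilon>" using shrink that i by blast
    then show ?thesis using t unfolding \<epsilon>_def by linarith
  qed
  then show "\<exists>N. \<forall>k\<ge>N. \<forall>l\<ge>N. \<bar>x k i - x l i\<bar> \<le> e" by blast
qed

section \<open>Convergence under an idempotent support\<close>

lemma kernel_op_funpow_bounded:
  assumes S: "finite S" and p: "stochastic_kernel S p" and "i \<in> S"
  shows "\<bar>(kernel_op S p ^^ k) g i\<bar> \<le> (\<Sum>j\<in>S. \<bar>g j\<bar>)"
  using assms(3)
proof (induction k arbitrary: i)
  case 0
  then show ?case using S by (auto intro: member_le_sum[of i S "\<lambda>j. \<bar>g j\<bar>"])
next
  case (Suc k)
  have "\<bar>(kernel_op S p ^^ Suc k) g i\<bar> \<le> (\<Sum>j\<in>S. \<bar>p i j * (kernel_op S p ^^ k) g j\<bar>)"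
    by (simp add: kernel_op_def[of S p "(kernel_op S p ^^ k) g"])
  also have "\<dots> \<le> (\<Sum>j\<in>S. p i j * (\<Sum>j\<in>S. \<bar>g j\<bar>))"
    unfolding abs_mult using stochastic_kernel_nonneg[OF p Suc.prems]
    by (intro sum_mono) (simp add: Suc.IH mult_left_mono)
  also have "\<dots> = (\<Sum>j\<in>S. \<bar>g j\<bar>)"
    by (simp add: stochastic_kernel_sum[OF p Suc.prems] flip: sum_distrib_right)
  finally show ?case .
qed

text \<open>Idempotence makes one-step reach transitive, so \<open>R\<close> only shrinks along
  transitions. By induction on \<open>card (R i)\<close>, states of \<open>R i\<close> with smaller
  reach are settled; those with equal reach see all of \<open>R i\<close> in one step, and the
  leaking or the positive case applies according to whether the former exist.\<close>

lemma convergent_kernel_op_funpow: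
  assumes S: "finite S" and p: "stochastic_kernel S p"
    and idem: "kernel_supp S p O kernel_supp S p = kernel_supp S p"
    and "i \<in> S"
  shows "convergent (\<lambda>k. (kernel_op S p ^^ k) g i)"
proof -
  define x where "x k = (kernel_op S p ^^ k) g" for k
  define R where "R i = {j \<in> S. 0 < p i j}" for i
  have finR: "finite (R i)" for i using S by (simp add: R_def)
  have RS: "R i \<subseteq> S" for i by (auto simp: R_def)
  note pn = stochastic_kernel_nonneg[OF p]
  have R_trans: "R j \<subseteq> R i" if "i \<in> S" "j \<in> R i" for i j
  proof
    fix l assume "l \<in> R j"
    then have "(i, l) \<in> kernel_supp S p O kernel_supp S p"
      using that by (auto simp: R_def kernel_supp_def)
    then show "l \<in> R i" unfolding idem by (auto simp: R_def kernel_supp_def)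
  qed
  have supp_sum: "(\<Sum>j\<in>S. p i j * f j) = (\<Sum>j\<in>U. p i j * f j)"
    if "i \<in> S" "R i \<subseteq> U" "U \<subseteq> S" for i U f
    using that S pn by (intro sum.mono_neutral_right) (auto simp: R_def less_le)
  have x_Suc: "x (Suc k) i = (\<Sum>j\<in>U. p i j * x k j)" if "i \<in> S" "R i \<subseteq> U" "U \<subseteq> S" for i k U
    using supp_sum[OF that] by (simp add: x_def kernel_op_def[of S p "(kernel_op S p ^^ k) g"])
  have sum1: "(\<Sum>j\<in>U. p i j) = 1" if "i \<in> S" "R i \<subseteq> U" "U \<subseteq> S" for i U
    using supp_sum[OF that, of "\<lambda>_. 1"] stochastic_kernel_sum[OF p that(1)] by simp
  obtain \<delta> where \<delta>: "0 < \<delta>" "\<delta> \<le> 1" "\<And>i j. i \<in> S \<Longrightarrow> j \<in> R i \<Longrightarrow> \<delta> \<le> p i j"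
  proof
    \<comment> \<open>Inserting 1 gives \<open>\<delta> \<le> 1\<close> and keeps the set nonempty
      for \<open>Min\<close>.\<close>
    let ?D = "insert 1 {p i j |i j. i \<in> S \<and> j \<in> R i}"
    have "?D = insert 1 (\<Union>i\<in>S. p i ` R i)" by auto
    then have fin: "finite ?D" using S finR by simp
    show "0 < Min ?D" using fin by (subst Min_gr_iff) (auto simp: R_def)
    show "Min ?D \<le> 1" using fin by (intro Min_le) auto
    show "Min ?D \<le> p i j" if "i \<in> S" "j \<in> R i" for i j using fin that by (intro Min_le) auto
  qed
  have "convergent (\<lambda>k. x k i)" if "i \<in> S" for i
    using that
  proof (induction "card (R i)" arbitrary: i rule: less_induct)
    case less
    define V where "V = {j \<in> R i. R j = R i}"
    define W where "W = R i - V"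
    have VW: "V \<union> W = R i" "V \<inter> W = {}" by (auto simp: V_def W_def)
    have fin: "finite V" "finite W" using finR[of i] by (auto simp: V_def W_def)
    have VS: "j \<in> S" "R j \<subseteq> R i" "R j = R i" if "j \<in> V" for j using that RS by (auto simp: V_def)
    have W: "convergent (\<lambda>k. x k j)" if "j \<in> W" for j
    proof (rule less.hyps)
      have j: "j \<in> R i" "R j \<noteq> R i" using that by (auto simp: W_def V_def)
      then show "card (R j) < card (R i)"
        using R_trans[OF less.prems, of j] finR by (intro psubset_card_mono) auto
      show "j \<in> S" using j RS by blast
    qed
    have V: "convergent (\<lambda>k. x k j)" if j: "j \<in> V" for j
    proof (cases "W = {}")
      case True
      then have V: "V = R i" using VW by simp
      show ?thesis
      proof (rule convergent_positive_averages[OF fin(1) _ \<delta>(1) _ _ j])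
        fix l assume "l \<in> V"
        note l = VS(1)[OF this] VS(2)[OF this] VS(3)[OF this]
        show "(\<Sum>m\<in>V. p l m) = 1" unfolding V by (rule sum1[OF l(1,2) RS])
        show "x (Suc k) l = (\<Sum>m\<in>V. p l m * x k m)" for k unfolding V by (rule x_Suc[OF l(1,2) RS])
        show "\<delta> \<le> p l m" if "m \<in> V" for m using that unfolding V l(3)[symmetric] by (rule \<delta>(3)[OF l(1)])
      qed
    next
      case False
      then obtain w where w: "w \<in> W" by blast
      have leak: "(\<Sum>m\<in>V. p l m) \<le> 1 - \<delta>" if "l \<in> V" for l
      proof -
        have lS: "l \<in> S" using VS that by blast
        have "(\<Sum>m\<in>V. p l m) + (\<Sum>m\<in>W. p l m) = 1"
          using sum.union_disjoint[OF fin VW(2), of "p l"] sum1[OF lS VS(2)[OF that] RS]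
          unfolding VW(1) by simp
        moreover have "p l w \<le> (\<Sum>m\<in>W. p l m)"
          using w fin pn lS RS[of i] VW by (intro member_le_sum) auto
        \<comment> \<open>\<open>w\<close> lies in \<open>R i\<close>, which equals
          \<open>R l\<close>, so the transition from \<open>l\<close> to \<open>w\<close> alone
          loses \<open>\<delta>\<close> of the weight.\<close>
        moreover have "\<delta> \<le> p l w" using VS[OF that] w VW by (intro \<delta>(3)) auto
        ultimately show ?thesis by linarith
      qed
      show ?thesis
      proof (rule convergent_leaking_averages[OF fin VW(2) _ _ \<delta>(1,2) leak _ _ W j])
        show "0 \<le> p l m" if "l \<in> V" "m \<in> V \<union> W" for l m
          using that VS(1) RS[of i] unfolding VW(1) by (intro pn) blast+
        show "(\<Sum>m\<in>V \<union> W. p l m) \<le> 1" if "l \<in> V" for l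
          unfolding VW(1) sum1[OF VS(1,2)[OF that] RS] ..
        show "\<bar>x k l\<bar> \<le> (\<Sum>j\<in>S. \<bar>g j\<bar>)" if "l \<in> V" for k l
          unfolding x_def using kernel_op_funpow_bounded[OF S p] VS that by blast
        show "x (Suc k) l = (\<Sum>m\<in>V \<union> W. p l m * x k m)" if "l \<in> V" for k l
          unfolding VW(1) by (rule x_Suc[OF VS(1,2)[OF that] RS])
      qed
    qed
    \<comment> \<open>\<open>i\<close> may lie outside \<open>R i\<close>, but its next value is an
      average over \<open>R i\<close>, and dropping one term does not affect convergence.\<close>
    have "convergent (\<lambda>k. \<Sum>j\<in>R i. p i j * x k j)"
    proof (intro convergent_sum convergent_mult convergent_const)
      show "convergent (\<lambda>k. x k j)" if "j \<in> R i" for j using that V W VW by blast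
    qed
    then have "convergent (\<lambda>k. x (Suc k) i)"
      using x_Suc[of i "R i"] less.prems RS by simp
    then show ?case by (simp add: convergent_Suc_iff[of "\<lambda>k. x k i"])
  qed
  then show ?thesis using assms(4) by (simp add: x_def)
qed

text \<open>The power of the kernel with idempotent support satisfies the previous lemma. One
  \<open>d\<close> serves all \<open>g\<close>, \<open>i\<close> and \<open>r\<close>, since it is
  chosen from the support of \<open>p\<close> alone.\<close>

theorem kernel_op_convergent_residues:
  assumes S: "finite S" and p: "stochastic_kernel S p"
  obtains d where "0 < d"
    and "\<And>g i r. i \<in> S \<Longrightarrow> convergent (\<lambda>k. (kernel_op S p ^^ (d * k + r)) g i)"
proof -
  have "kernel_supp S p \<subseteq> S \<times> S" by (auto simp: kernel_supp_def)
  then obtain d where d: "0 < d" "kernel_supp S p ^^ d O kernel_supp S p ^^ d = kernel_supp S p ^^ d"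
    using relpow_idempotent_exists[OF S] by blast
  show thesis
  proof (rule that[OF d(1)])
    fix g r and i assume i: "i \<in> S"
    \<comment> \<open>The residue \<open>r\<close> is absorbed into the starting function.\<close>
    have "convergent (\<lambda>k. (kernel_op S (kernel_pow S p d) ^^ k) ((kernel_op S p ^^ r) g) i)"
      using d i by (intro convergent_kernel_op_funpow S stochastic_kernel_pow p)
        (simp_all add: kernel_supp_pow[OF S p d(1)])
    then show "convergent (\<lambda>k. (kernel_op S p ^^ (d * k + r)) g i)"
      by (simp add: kernel_op_pow_funpow[OF S i] funpow_add)
  qed
qed

subsection \<open>Unary automata\<close>

text \<open>A lasso-shaped automaton with a tail of length \<open>N\<close> and a cycle of length \<open>d\<close>.\<close>

lemma unary_dfa_exists:
  fixes Y Z :: "nat set" and a :: 'a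
  assumes d: "0 < d"
    and tail: "Y \<inter> Z = {}"
    and loop: "\<And>m m'. m \<in> Y \<Longrightarrow> m' \<in> Z \<Longrightarrow> N \<le> m \<Longrightarrow> N \<le> m' \<Longrightarrow> m mod d \<noteq> m' mod d"
  shows "\<exists>D :: (nat, 'a) dfa. is_dfa D \<and> dfa_alphabet D = {a} \<and>
    (\<forall>m\<in>Y. dfa_accepts D (replicate m a)) \<and> (\<forall>m\<in>Z. \<not> dfa_accepts D (replicate m a))"
proof -
  define \<tau> :: "nat \<Rightarrow> 'a \<Rightarrow> nat" where "\<tau> = (\<lambda>q _. if Suc q < N + d then Suc q else N)"
  \<comment> \<open>Closed form of the state after \<open>m\<close> letters; \<open>run\<close>
    confirms it.\<close>
  define st where "st m = (if m < N then m else N + (m - N) mod d)" for m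
  have st_lt: "st m < N + d" for m using d by (simp add: st_def)
  have run: "((\<lambda>q. \<tau> q a) ^^ m) 0 = st m" for m
  proof (induction m)
    case 0
    then show ?case by (simp add: st_def)
  next
    case (Suc m)
    \<comment> \<open>The middle case is the step from the tail into the cycle.\<close>
    consider "Suc m < N" | "Suc m = N" | "N \<le> m" by linarith
    then have "\<tau> (st m) a = st (Suc m)"
    proof cases
      case 3
      define q where "q = (m - N) mod d"
      have "st m = N + q" using 3 by (simp add: st_def q_def)
      moreover have "st (Suc m) = N + (if Suc q = d then 0 else Suc q)"
        using 3 by (simp add: st_def Suc_diff_le mod_Suc q_def)
      moreover have "q < d" unfolding q_def using d by (rule mod_less_divisor)
      ultimately show ?thesis by (simp add: \<tau>_def)
    qed (use d in \<open>simp_all add: \<tau>_def st_def\<close>)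
    then show ?case using Suc.IH by simp
  qed
  \<comment> \<open>Equal states force equal lengths if one lies on the tail, and equal residues on
    the cycle.\<close>
  have sep: "st m \<noteq> st m'" if "m \<in> Y" "m' \<in> Z" for m m'
  proof
    assume eq: "st m = st m'"
    show False
    proof (cases "m < N \<or> m' < N")
      case True
      then have "m = m'" using eq by (auto simp: st_def split: if_splits)
      then show False using tail that by blast
    next
      case False
      then have "(m - N) mod d = (m' - N) mod d" using eq by (simp add: st_def)
      then have "(N + (m - N)) mod d = (N + (m' - N)) mod d" by (rule mod_add_cong[OF refl])
      then have "m mod d = m' mod d" using False by simp
      then show False using loop[OF that] False by simp
    qed
  qed
  \<comment> \<open>Taking the image of \<open>Y\<close> as accepting set settles \<open>Y\<close>
    at once; \<open>sep\<close> keeps the lengths in \<open>Z\<close> out of it.\<close>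
  define D :: "(nat, 'a) dfa" where
    "D = \<lparr>dfa_states = {..<N + d}, dfa_alphabet = {a}, dfa_trans = \<tau>, dfa_init = 0, dfa_accepting = st ` Y\<rparr>"
  show ?thesis
  proof (intro exI[of _ D] conjI ballI)
    have "\<tau> q b < N + d" for q b using d by (simp add: \<tau>_def)
    then show "is_dfa D" using d st_lt by (simp add: is_dfa_def D_def image_subset_iff)
    show "dfa_alphabet D = {a}" by (simp add: D_def)
    show "dfa_accepts D (replicate m a)" if "m \<in> Y" for m
      using that by (simp add: dfa_accepts_def D_def run)
    show "\<not> dfa_accepts D (replicate m a)" if "m \<in> Z" for m
      using sep[OF _ that] by (simp add: dfa_accepts_def D_def run image_iff) metis
  qed
qed

section \<open>Acceptance probabilities of unary inputs\<close>

text \<open>Iterated pairing identity for \<open>A\<close> and its transpose: one application moves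
  from the vector to the function by exchanging sums. The induction varies \<open>v\<close> because
  its hypothesis is applied to \<open>A *\<^sub>v v\<close>.\<close>

lemma kernel_op_transpose:
  fixes A :: "real mat"
  assumes "A \<in> carrier_mat n n" and "v \<in> carrier_vec n"
  shows "(\<Sum>j<n. g j * ((\<lambda>v. A *\<^sub>v v) ^^ m) v $ j)
       = (\<Sum>i<n. (kernel_op {..<n} (\<lambda>i j. A $$ (j, i)) ^^ m) g i * v $ i)"
  using assms(2)
proof (induction m arbitrary: v)
  case 0
  then show ?case by simp
next
  case (Suc m)
  let ?h = "(kernel_op {..<n} (\<lambda>i j. A $$ (j, i)) ^^ m) g"
  have Av: "A *\<^sub>v v \<in> carrier_vec n" using assms(1) Suc.prems by simp
  have "(\<Sum>j<n. g j * ((\<lambda>v. A *\<^sub>v v) ^^ Suc m) v $ j) = (\<Sum>j<n. ?h j * (A *\<^sub>v v) $ j)"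
    using Suc.IH[OF Av] by (simp add: funpow_swap1)
  also have "\<dots> = (\<Sum>j<n. \<Sum>i<n. ?h j * (A $$ (j, i) * v $ i))"
    using assms(1) Suc.prems
    by (intro sum.cong refl) (auto simp: scalar_prod_def sum_distrib_left atLeast0LessThan)
  also have "\<dots> = (\<Sum>i<n. \<Sum>j<n. ?h j * (A $$ (j, i) * v $ i))" by (rule sum.swap)
  also have "\<dots> = (\<Sum>i<n. kernel_op {..<n} (\<lambda>i j. A $$ (j, i)) ?h i * v $ i)"
    by (simp add: kernel_op_def[of "{..<n}" "\<lambda>i j. A $$ (j, i)" ?h] sum_distrib_right sum_distrib_left mult_ac)
  finally show ?case by simp
qed

lemma stochastic_kernel_transpose:
  assumes "column_stochastic n A"
  shows "stochastic_kernel {..<n} (\<lambda>i j. A $$ (j, i))"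
  unfolding stochastic_kernel_def
proof (intro ballI conjI)
  fix i assume i: "i \<in> {..<n}"
  have A: "A \<in> carrier_mat n n" and st: "stochastic_vec n (col A i)"
    using assms i by (auto simp: column_stochastic_def)
  have col: "col A i $ j = A $$ (j, i)" if "j < n" for j using A i that by simp
  show "0 \<le> A $$ (j, i)" if "j \<in> {..<n}" for j
    using st that col[of j] unfolding stochastic_vec_def by fastforce
  show "(\<Sum>j<n. A $$ (j, i)) = 1"
    using st col by (simp add: stochastic_vec_def)
qed

text \<open>With \<open>g\<close> the indicator of the accepting states, the acceptance probability
  is a finite combination of iterated averages of \<open>g\<close> with the fixed weights
  \<open>v $ i\<close>.\<close>

lemma pfa_acc_prob_convergent_residues:
  assumes M: "is_pfa M" and a: "a \<in> pfa_alphabet M"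
  obtains d where "0 < d" and "\<And>r. convergent (\<lambda>k. pfa_acc_prob M (replicate (d * k + r) a))"
proof -
  define n where "n = pfa_dim M"
  define A where "A = pfa_mat M a"
  define v where "v = pfa_init M"
  define p where "p = (\<lambda>i j. A $$ (j, i))"
  define g :: "nat \<Rightarrow> real" where "g j = (if j \<in> pfa_accepting M then 1 else 0)" for j
  have A: "column_stochastic n A" and v: "v \<in> carrier_vec n" and acc: "pfa_accepting M \<subseteq> {..<n}"
    using M a by (auto simp: is_pfa_def n_def A_def v_def stochastic_vec_def)
  have AC: "A \<in> carrier_mat n n" using A by (simp add: column_stochastic_def)
  obtain d where d: "0 < d"
    and conv: "\<And>g i r. i \<in> {..<n} \<Longrightarrow> convergent (\<lambda>k. (kernel_op {..<n} p ^^ (d * k + r)) g i)"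
    using kernel_op_convergent_residues[OF finite_lessThan stochastic_kernel_transpose[OF A]]
    unfolding p_def by blast
  have prob: "pfa_acc_prob M (replicate m a) = (\<Sum>i<n. (kernel_op {..<n} p ^^ m) g i * v $ i)" for m
  proof -
    have "pfa_acc_prob M (replicate m a) = (\<Sum>j\<in>pfa_accepting M. ((\<lambda>v. A *\<^sub>v v) ^^ m) v $ j)"
      by (simp add: pfa_acc_prob_def pfa_final_vec_def A_def v_def)
    also have "\<dots> = (\<Sum>j<n. g j * ((\<lambda>v. A *\<^sub>v v) ^^ m) v $ j)"
      using acc by (intro sum.mono_neutral_cong_left) (auto simp: g_def)
    finally show ?thesis using kernel_op_transpose[OF AC v] by (simp add: p_def)
  qed
  show thesis
  proof (rule that[OF d])
    show "convergent (\<lambda>k. pfa_acc_prob M (replicate (d * k + r) a))" for r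
      unfolding prob by (intro convergent_sum convergent_mult convergent_const conv)
  qed
qed

text \<open>There are only \<open>d\<close> residues, so the Cauchy thresholds of the single classes
  combine into one.\<close>

lemma residues_eventually_close:
  fixes f :: "nat \<Rightarrow> real"
  assumes d: "0 < d" and f: "\<And>r. convergent (\<lambda>k. f (d * k + r))" and e: "0 < e"
  obtains N where "\<And>m m'. N \<le> m \<Longrightarrow> N \<le> m' \<Longrightarrow> m mod d = m' mod d \<Longrightarrow> \<bar>f m - f m'\<bar> < e"
proof -
  have "\<exists>N. \<forall>k\<ge>N. \<forall>l\<ge>N. \<bar>f (d * k + r) - f (d * l + r)\<bar> < e" for r
    using f[of r] e by (auto simp: Cauchy_def dist_real_def simp flip: Cauchy_convergent_iff)
  then obtain n where n: "\<And>r k l. n r \<le> k \<Longrightarrow> n r \<le> l \<Longrightarrow> \<bar>f (d * k + r) - f (d * l + r)\<bar> < e"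
    by metis
  \<comment> \<open>From \<open>N\<close> on, the quotient \<open>m div d\<close> is at least every
    class threshold \<open>n r\<close> with \<open>r < d\<close>.\<close>
  define N where "N = d * (\<Sum>r<d. n r)"
  have big: "n (m mod d) \<le> m div d" if "N \<le> m" for m
  proof -
    have "n (m mod d) \<le> (\<Sum>r<d. n r)" using d by (intro member_le_sum) auto
    also have "\<dots> \<le> m div d" using that d by (simp add: N_def less_eq_div_iff_mult_less_eq mult.commute)
    finally show ?thesis .
  qed
  show thesis
  proof (rule that[of N])
    fix m m' assume *: "N \<le> m" "N \<le> m'" "m mod d = m' mod d"
    then have "\<bar>f (d * (m div d) + m mod d) - f (d * (m' div d) + m mod d)\<bar> < e"
      using big[OF *(1)] big[OF *(2)] by (intro n) auto
    then show "\<bar>f m - f m'\<bar> < e" using *(3) by (metis mult_div_mod_eq)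
  qed
qed

section \<open>Separation of yes- and no-instances\<close>

theorem theorem3:
  fixes P :: "'a promise_problem" and a :: 'a and M :: "'a pfa" and \<epsilon> :: real
  assumes "promise_problem {a} P"
    and "is_pfa M" and "pfa_alphabet M = {a}"
    and "\<epsilon> < 1 / 2"
    and "pfa_solves M P \<epsilon>"
  shows "\<exists>D :: (nat, 'a) dfa. is_dfa D \<and> dfa_alphabet D = {a} \<and> dfa_solves D P"
proof -
  define f where "f m = pfa_acc_prob M (replicate m a)" for m
  define Y where "Y = {m. replicate m a \<in> fst P}"
  define Z where "Z = {m. replicate m a \<in> snd P}"
  obtain d where d: "0 < d" "\<And>r. convergent (\<lambda>k. f (d * k + r))"
    using pfa_acc_prob_convergent_residues[OF assms(2), of a] assms(3) by (auto simp: f_def)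
  have gap_pos: "0 < 1 - 2 * \<epsilon>" using assms(4) by simp
  \<comment> \<open>The tolerance is the gap itself: from \<open>N\<close> on, values within a
    residue class differ by less than those of a yes- and a no-instance must.\<close>
  obtain N where N: "\<And>m m'. N \<le> m \<Longrightarrow> N \<le> m' \<Longrightarrow> m mod d = m' mod d \<Longrightarrow> \<bar>f m - f m'\<bar> < 1 - 2 * \<epsilon>"
    using residues_eventually_close[OF d, of "1 - 2 * \<epsilon>"] gap_pos by blast
  have gap: "1 - 2 * \<epsilon> \<le> f m - f m'" if "m \<in> Y" "m' \<in> Z" for m m'
  proof -
    have "1 - \<epsilon> \<le> f m" "1 - \<epsilon> \<le> 1 - f m'"
      using assms(5) that by (auto simp: pfa_solves_def pfa_rej_prob_def Y_def Z_def f_def)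
    then show ?thesis by simp
  qed
  have disj: "Y \<inter> Z = {}" using assms(1) by (auto simp: promise_problem_def Y_def Z_def)
  have loop: "m mod d \<noteq> m' mod d" if "m \<in> Y" "m' \<in> Z" "N \<le> m" "N \<le> m'" for m m'
    using gap[OF that(1,2)] N[OF that(3,4)] by linarith
  have "\<exists>D :: (nat, 'a) dfa. is_dfa D \<and> dfa_alphabet D = {a} \<and>
    (\<forall>m\<in>Y. dfa_accepts D (replicate m a)) \<and> (\<forall>m\<in>Z. \<not> dfa_accepts D (replicate m a))"
    using d(1) disj by (rule unary_dfa_exists) (rule loop)
  then obtain D :: "(nat, 'a) dfa" where D: "is_dfa D" "dfa_alphabet D = {a}"
    "\<forall>m\<in>Y. dfa_accepts D (replicate m a)" "\<forall>m\<in>Z. \<not> dfa_accepts D (replicate m a)" by blast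
  \<comment> \<open>Words over one letter are determined by their length, so statements about
    exponents transfer to words.\<close>
  have unary: "\<exists>m. w = replicate m a" if "w \<in> fst P \<union> snd P" for w
  proof
    show "w = replicate (length w) a"
      using assms(1) that
      by (intro replicate_length_same[symmetric]) (auto simp: promise_problem_def in_lists_conv_set)
  qed
  have "dfa_accepts D w" if w: "w \<in> fst P" for w
  proof -
    obtain m where "w = replicate m a" using unary w by blast
    then show ?thesis using D(3) w by (simp add: Y_def)
  qed
  moreover have "\<not> dfa_accepts D w" if w: "w \<in> snd P" for w
  proof -
    obtain m where "w = replicate m a" using unary w by blast
    then show ?thesis using D(4) w by (simp add: Z_def)
  qed
  ultimately show ?thesis using D(1,2) unfolding dfa_solves_def by blast
qed

end
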